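(* Let $M\subseteq N$ and let $m\in\mathcal{K}(N)$ be the lifting of $r\in\mathcal{K}(M)$ to $N$, that is, $m(S)=r(S\cap M)$ for every $S\subseteq N$. Then $m$ is extreme in $\mathcal{K}(N)$ if and only if $r$ is extreme in $\mathcal{K}(M)$.
   Context: $N$ is a finite set with $|N|\ge 2$ and $\mathcal{P}(N)$ is its power set. $\mathbb{R}^{\mathcal{P}(N)}$ is the space of functions $m:\mathcal{P}(N)\to\mathbb{R}$ with scalar product $\langle m,u\rangle=\sum_{A\subseteq N}m(A)u(A)$. A function $m$ is supermodular if $m(A)+m(B)\le m(A\cup B)+m(A\cap B)$ for all $A,B\subseteq N$; $\mathcal{K}(N)$ is the cone of supermodular functions. A face of a convex cone $K\subseteq\mathbb{R}^{\mathcal{P}(N)}$ is a set $\{m\in K: k=\langle m,v\rangle\}$, where $v\in\mathbb{R}^{\mathcal{P}(N)}$, $k\in\mathbb{R}$ satisfy $k\le\langle m,v\rangle$ for all $m\in K$. The non-empty faces of $\mathcal{K}(N)$ form a lattice under inclusion with least element the space of modular functions $\mathcal{K}(N)\cap(-\mathcal{K}(N))$. A function $m\in\mathcal{K}(N)$ is extreme in $\mathcal{K}(N)$ if the smallest face of $\mathcal{K}(N)$ containing $m$ is an atom of this lattice. The same definitions are used for other finite sets in place of $N$. *)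

theory Defs
  imports Complex_Main "HOL-Library.FuncSet"
begin

(* A real function on the power set of N is represented by an extensional function, i.e. one
   with the fixed value undefined outside Pow N, so that equality of such functions is
   equality on Pow N. *)
definition set_functions :: "'a set \<Rightarrow> ('a set \<Rightarrow> real) set" where
  "set_functions N = Pow N \<rightarrow>\<^sub>E UNIV"

definition scalar_product :: "'a set \<Rightarrow> ('a set \<Rightarrow> real) \<Rightarrow> ('a set \<Rightarrow> real) \<Rightarrow> real" where
  "scalar_product N m u = (\<Sum>A\<in>Pow N. m A * u A)"

definition supermodular_cone :: "'a set \<Rightarrow> ('a set \<Rightarrow> real) set" where
  "supermodular_cone N =
     {m \<in> set_functions N. \<forall>A\<in>Pow N. \<forall>B\<in>Pow N. m A + m B \<le> m (A \<union> B) + m (A \<inter> B)}"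

definition faces :: "'a set \<Rightarrow> ('a set \<Rightarrow> real) set \<Rightarrow> ('a set \<Rightarrow> real) set set" where
  "faces N K =
     {{m \<in> K. k = scalar_product N m v} | v k.
        v \<in> set_functions N \<and> (\<forall>m\<in>K. k \<le> scalar_product N m v)}"

(* The empty set may occur as a face (v = 0, k < 0); the face lattice excludes it. *)
definition face_lattice :: "'a set \<Rightarrow> ('a set \<Rightarrow> real) set set" where
  "face_lattice N = faces N (supermodular_cone N) - {{}}"

definition is_least :: "'b set set \<Rightarrow> 'b set \<Rightarrow> bool" where
  "is_least L Z \<longleftrightarrow> Z \<in> L \<and> (\<forall>G\<in>L. Z \<subseteq> G)"

definition is_atom :: "'b set set \<Rightarrow> 'b set \<Rightarrow> bool" where
  "is_atom L F \<longleftrightarrow>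
     F \<in> L \<and> (\<exists>Z. is_least L Z \<and> F \<noteq> Z \<and> (\<forall>G\<in>L. G \<subseteq> F \<longrightarrow> G = Z \<or> G = F))"

definition extreme :: "'a set \<Rightarrow> ('a set \<Rightarrow> real) \<Rightarrow> bool" where
  "extreme N m \<longleftrightarrow> m \<in> supermodular_cone N \<and>
     (\<exists>F. is_least {G \<in> faces N (supermodular_cone N). m \<in> G} F \<and> is_atom (face_lattice N) F)"

definition lifting :: "'a set \<Rightarrow> 'a set \<Rightarrow> ('a set \<Rightarrow> real) \<Rightarrow> 'a set \<Rightarrow> real" where
  "lifting M N r = (\<lambda>S\<in>Pow N. r (S \<inter> M))"

lemma lifting_in_supermodular_cone:
  assumes "r \<in> supermodular_cone M"
  shows "lifting M N r \<in> supermodular_cone N"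
proof -
  have "r (A \<inter> M) + r (B \<inter> M) \<le> r ((A \<union> B) \<inter> M) + r (A \<inter> B \<inter> M)" for A B
  proof -
    have "A \<inter> M \<in> Pow M" "B \<inter> M \<in> Pow M" by auto
    then have "r (A \<inter> M) + r (B \<inter> M)
        \<le> r ((A \<inter> M) \<union> (B \<inter> M)) + r ((A \<inter> M) \<inter> (B \<inter> M))"
      using assms unfolding supermodular_cone_def by blast
    moreover have "(A \<inter> M) \<union> (B \<inter> M) = (A \<union> B) \<inter> M"
      and "(A \<inter> M) \<inter> (B \<inter> M) = A \<inter> B \<inter> M" by auto
    ultimately show ?thesis by simp
  qed
  then show ?thesis
    by (auto simp: supermodular_cone_def set_functions_def lifting_def)
qed

end

(* The smallest face of the supermodular cone containing m consists of the supermodular functions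
   satisfying with equality every supermodular inequality that m satisfies with equality: such an x
   can be subtracted from m with a small positive coefficient without leaving the cone.  Hence m is
   extreme iff it is not modular and no non-modular supermodular function has a strictly larger
   set of tight inequalities.  If x is tight wherever the lifting of r is tight, then x
   is modular on subsets of N - M and splits additively over M and N - M, so the defects of
   x are those of its restriction to M; this reduces the condition for N to that for M. *)
theory Submission
  imports Defs
begin

section \<open>Defects and tight pairs\<close>

definition defect :: "('a set \<Rightarrow> real) \<Rightarrow> 'a set \<Rightarrow> 'a set \<Rightarrow> real" where
  "defect x A B = x (A \<union> B) + x (A \<inter> B) - x A - x B"

definition tight :: "'a set \<Rightarrow> ('a set \<Rightarrow> real) \<Rightarrow> ('a set \<times> 'a set) set" where
  "tight N x = {(A, B) \<in> Pow N \<times> Pow N. defect x A B = 0}"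

text \<open>The set \<open>T\<close> is arbitrary, so that one formula covers both the smallest face
  through \<open>m\<close>, with \<open>T = tight N m\<close>, and the modular functions, with
  \<open>T = Pow N \<times> Pow N\<close>.\<close>

definition tight_face :: "'a set \<Rightarrow> ('a set \<times> 'a set) set \<Rightarrow> ('a set \<Rightarrow> real) set" where
  "tight_face N T = {x \<in> supermodular_cone N. T \<subseteq> tight N x}"

text \<open>Restricting to \<open>Pow N\<close> keeps the result extensional, as membership in
  \<open>set_functions N\<close> demands.\<close>

definition lincomb ::
  "'a set \<Rightarrow> real \<Rightarrow> ('a set \<Rightarrow> real) \<Rightarrow> real \<Rightarrow> ('a set \<Rightarrow> real) \<Rightarrow> 'a set \<Rightarrow> real" where
  "lincomb N a x b y = (\<lambda>A\<in>Pow N. a * x A + b * y A)"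

lemma supermodular_cone_iff:
  "x \<in> supermodular_cone N \<longleftrightarrow>
     x \<in> set_functions N \<and> (\<forall>A\<in>Pow N. \<forall>B\<in>Pow N. 0 \<le> defect x A B)"
proof -
  have "x A + x B \<le> x (A \<union> B) + x (A \<inter> B) \<longleftrightarrow> 0 \<le> defect x A B" for A B
    by (auto simp: defect_def)
  then show ?thesis
    by (simp add: supermodular_cone_def)
qed

lemma tight_iff: "(A, B) \<in> tight N x \<longleftrightarrow> A \<subseteq> N \<and> B \<subseteq> N \<and> defect x A B = 0"
  by (auto simp: tight_def)

lemma tight_subset: "tight N x \<subseteq> Pow N \<times> Pow N"
  by (auto simp: tight_def)

section \<open>Moving inside the cone by linear combinations\<close>

lemma scalar_product_lincomb:
  "scalar_product N (lincomb N a x b y) v = a * scalar_product N x v + b * scalar_product N y v"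
proof -
  have "scalar_product N (lincomb N a x b y) v = (\<Sum>A\<in>Pow N. a * (x A * v A) + b * (y A * v A))"
    unfolding scalar_product_def
    by (rule sum.cong) (auto simp: lincomb_def algebra_simps)
  then show ?thesis
    by (simp add: scalar_product_def sum.distrib sum_distrib_left)
qed

lemma defect_lincomb:
  assumes "A \<subseteq> N" "B \<subseteq> N"
  shows "defect (lincomb N a x b y) A B = a * defect x A B + b * defect y A B"
proof -
  have "A \<union> B \<subseteq> N" "A \<inter> B \<subseteq> N" using assms by auto
  with assms show ?thesis
    by (simp add: defect_def lincomb_def algebra_simps)
qed

lemma lincomb_in_supermodular_cone:
  assumes "\<And>A B. A \<subseteq> N \<Longrightarrow> B \<subseteq> N \<Longrightarrow> 0 \<le> a * defect x A B + b * defect y A B"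
  shows "lincomb N a x b y \<in> supermodular_cone N"
proof -
  have "lincomb N a x b y \<in> set_functions N"
    by (simp add: lincomb_def set_functions_def)
  with assms show ?thesis
    by (simp add: supermodular_cone_iff defect_lincomb)
qed

lemma ex_uniform_scaling:
  fixes f g :: "'b \<Rightarrow> real"
  assumes "finite P" "\<forall>p\<in>P. 0 \<le> f p \<and> 0 \<le> g p \<and> (f p = 0 \<longrightarrow> g p = 0)"
  shows "\<exists>\<epsilon>>0. \<forall>p\<in>P. \<epsilon> * g p \<le> f p"
  using assms
proof (induction P rule: finite_induct)
  case empty
  show ?case by (auto intro: exI[of _ 1])
next
  case (insert q P)
  then obtain \<epsilon> where \<epsilon>: "\<epsilon> > 0" "\<And>p. p \<in> P \<Longrightarrow> \<epsilon> * g p \<le> f p" by auto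
  \<comment> \<open>The constant for \<open>P\<close> is shrunk until it also serves
    \<open>q\<close>. If \<open>g q = 0\<close>, the new point imposes nothing; otherwise
    \<open>f q\<close> is nonzero, which makes the quotient positive.\<close>
  define \<delta> where "\<delta> = (if g q = 0 then \<epsilon> else min \<epsilon> (f q / g q))"
  have q: "0 \<le> f q" "0 \<le> g q" "f q = 0 \<longrightarrow> g q = 0" using insert.prems by auto
  have "f q / g q > 0" if "g q \<noteq> 0"
    using q that by (intro divide_pos_pos) (auto simp: less_le)
  then have "\<delta> > 0" "\<delta> \<le> \<epsilon>"
    using \<epsilon>(1) by (auto simp: \<delta>_def)
  moreover have "\<delta> * g q \<le> f q"
  proof (cases "g q = 0")
    case False
    with q have "g q > 0" by simp
    moreover have "\<delta> \<le> f q / g q" using False by (simp add: \<delta>_def)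
    ultimately show ?thesis by (simp add: pos_le_divide_eq)
  qed (use q in simp)
  moreover have "\<delta> * g p \<le> f p" if "p \<in> P" for p
  proof -
    have "\<delta> * g p \<le> \<epsilon> * g p"
      using \<open>\<delta> \<le> \<epsilon>\<close> insert.prems that by (intro mult_right_mono) auto
    with \<epsilon>(2)[OF that] show ?thesis by simp
  qed
  ultimately show ?case by auto
qed

text \<open>Where \<open>m\<close> has a positive defect there is room to subtract a small multiple
  of \<open>x\<close>, and elsewhere the defect of \<open>x\<close> vanishes too. So
  \<open>m + x\<close> and \<open>m - \<epsilon> x\<close> both lie in the cone, and the inequality
  supporting the face, applied to both, forces \<open>x\<close> into the face.\<close>

lemma face_upward_closed:
  assumes "finite N" and G: "G \<in> faces N (supermodular_cone N)" and "m \<in> G"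
    and x: "x \<in> supermodular_cone N" and sub: "tight N m \<subseteq> tight N x"
  shows "x \<in> G"
proof -
  obtain v k where G_eq: "G = {m \<in> supermodular_cone N. k = scalar_product N m v}"
    and bound: "\<And>y. y \<in> supermodular_cone N \<Longrightarrow> k \<le> scalar_product N y v"
    using G by (auto simp: faces_def)
  have m: "m \<in> supermodular_cone N" and k: "scalar_product N m v = k"
    using \<open>m \<in> G\<close> G_eq by auto
  have dm: "0 \<le> defect m A B" and dx: "0 \<le> defect x A B" if "A \<subseteq> N" "B \<subseteq> N" for A B
    using m x that by (auto simp: supermodular_cone_iff)
  have "defect m A B = 0 \<Longrightarrow> defect x A B = 0" if "A \<subseteq> N" "B \<subseteq> N" for A B
    using sub that by (auto simp: tight_def)
  then have "\<forall>p\<in>Pow N \<times> Pow N. 0 \<le> case_prod (defect m) p \<and> 0 \<le> case_prod (defect x) p \<and>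
      (case_prod (defect m) p = 0 \<longrightarrow> case_prod (defect x) p = 0)"
    using dm dx by auto
  then obtain \<epsilon> where \<epsilon>: "\<epsilon> > 0"
    and "\<forall>p\<in>Pow N \<times> Pow N. \<epsilon> * case_prod (defect x) p \<le> case_prod (defect m) p"
    using ex_uniform_scaling[of "Pow N \<times> Pow N" "case_prod (defect m)" "case_prod (defect x)"]
      \<open>finite N\<close> by auto
  then have le: "\<epsilon> * defect x A B \<le> defect m A B" if "A \<subseteq> N" "B \<subseteq> N" for A B
    using that by auto
  have comb: "k \<le> a * k + b * scalar_product N x v"
    if "\<And>A B. A \<subseteq> N \<Longrightarrow> B \<subseteq> N \<Longrightarrow> 0 \<le> a * defect m A B + b * defect x A B" for a b
    using bound[OF lincomb_in_supermodular_cone[OF that]] by (simp add: scalar_product_lincomb k)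
  \<comment> \<open>The zero function and \<open>2 m\<close> give \<open>k = 0\<close>; then
    \<open>m + x\<close> and \<open>m - \<epsilon> x\<close> bound the product of \<open>x\<close>
    and \<open>v\<close> by zero from below and from above.\<close>
  have "k \<le> 0" using comb[of 0 0] by simp
  moreover have "k \<ge> 0" using comb[of 2 0] dm by simp
  moreover have "scalar_product N x v \<ge> 0" using comb[of 1 1] dm dx by simp
  moreover have "\<epsilon> * scalar_product N x v \<le> 0" using comb[of 1 "- \<epsilon>"] le by simp
  then have "scalar_product N x v \<le> 0"
    using \<epsilon> by (simp add: mult_le_0_iff)
  ultimately show ?thesis using x G_eq by simp
qed

section \<open>Faces cut out by tight pairs\<close>

lemma sum_indicator_mult:
  fixes x :: "'b \<Rightarrow> real"
  assumes "finite S" "C \<in> S"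
  shows "(\<Sum>D\<in>S. x D * of_bool (D = C)) = x C"
  using assms by (simp add: of_bool_def if_distrib sum.delta cong: if_cong)

text \<open>Each defect is a linear functional that is nonnegative on the cone. Their sum over
  \<open>T\<close> is therefore zero exactly where all of them are, and this single functional
  exposes the face, with constant 0.\<close>

lemma tight_face_in_faces:
  assumes "finite N" and T: "T \<subseteq> Pow N \<times> Pow N"
  shows "tight_face N T \<in> faces N (supermodular_cone N)"
proof -
  \<comment> \<open>The vector \<open>w (A, B)\<close> represents the defect at
    \<open>(A, B)\<close> in the scalar product. Adding four indicators gives the right coefficients
    even when some of the four sets coincide.\<close>
  define w :: "'a set \<times> 'a set \<Rightarrow> 'a set \<Rightarrow> real" where
    "w = (\<lambda>(A, B) C. of_bool (C = A \<union> B) + of_bool (C = A \<inter> B) - of_bool (C = A) - of_bool (C = B))"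
  define v where "v = (\<lambda>C\<in>Pow N. \<Sum>p\<in>T. w p C)"
  have "finite T" using assms by (meson finite_Pow_iff finite_SigmaI finite_subset)
  have w: "(\<Sum>C\<in>Pow N. x C * w p C) = case_prod (defect x) p" if "p \<in> T" for x p
  proof -
    obtain A B where p: "p = (A, B)" by (cases p)
    have "(A, B) \<in> Pow N \<times> Pow N" using subsetD[OF T that] p by simp
    then have "A \<in> Pow N" "B \<in> Pow N" "A \<union> B \<in> Pow N" "A \<inter> B \<in> Pow N" by auto
    then show ?thesis
      using \<open>finite N\<close> by (simp only: p w_def case_prod_conv distrib_left right_diff_distrib sum.distrib
          sum_subtractf sum_indicator_mult finite_Pow_iff defect_def)
  qed
  have sp: "scalar_product N x v = (\<Sum>p\<in>T. case_prod (defect x) p)" for x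
  proof -
    have "scalar_product N x v = (\<Sum>C\<in>Pow N. \<Sum>p\<in>T. x C * w p C)"
      by (simp add: scalar_product_def v_def sum_distrib_left)
    also have "\<dots> = (\<Sum>p\<in>T. \<Sum>C\<in>Pow N. x C * w p C)" by (rule sum.swap)
    finally show ?thesis by (simp add: w)
  qed
  have nonneg: "0 \<le> case_prod (defect x) p" if "x \<in> supermodular_cone N" "p \<in> T" for x p
    using subsetD[OF T that(2)] that(1) by (cases p) (simp add: supermodular_cone_iff)
  have "tight_face N T = {x \<in> supermodular_cone N. 0 = scalar_product N x v}"
  proof -
    have "T \<subseteq> tight N x \<longleftrightarrow> 0 = scalar_product N x v" if x: "x \<in> supermodular_cone N" for x
    proof -
      have "0 = scalar_product N x v \<longleftrightarrow> (\<forall>p\<in>T. case_prod (defect x) p = 0)"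
        unfolding sp
        by (subst eq_commute) (rule sum_nonneg_eq_0_iff[OF \<open>finite T\<close> nonneg[OF x]])
      moreover have "p \<in> tight N x \<longleftrightarrow> case_prod (defect x) p = 0" if "p \<in> T" for p
        using subsetD[OF T that] by (cases p) (simp add: tight_iff)
      ultimately show ?thesis by blast
    qed
    then show ?thesis by (auto simp: tight_face_def)
  qed
  moreover have "v \<in> set_functions N" by (simp add: v_def set_functions_def)
  moreover have "\<forall>x\<in>supermodular_cone N. 0 \<le> scalar_product N x v"
    unfolding sp by (intro ballI sum_nonneg nonneg)
  ultimately show ?thesis unfolding faces_def by blast
qed

lemma tight_face_nonempty:
  assumes "T \<subseteq> Pow N \<times> Pow N"
  shows "tight_face N T \<noteq> {}"
proof -
  \<comment> \<open>Whatever \<open>x\<close> is, this is the extensional zero function, which is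
    tight at every pair.\<close>
  have "lincomb N 0 x 0 x \<in> tight_face N T" for x
    using assms
    by (auto simp: tight_face_def tight_iff defect_lincomb lincomb_in_supermodular_cone)
  then show ?thesis by blast
qed

lemma tight_face_in_face_lattice:
  assumes "finite N" "T \<subseteq> Pow N \<times> Pow N"
  shows "tight_face N T \<in> face_lattice N"
  using tight_face_in_faces[OF assms] tight_face_nonempty[OF assms(2)]
  by (simp add: face_lattice_def)

section \<open>Least faces and extremality\<close>

lemma is_least_unique: "is_least L Y \<Longrightarrow> is_least L Z \<Longrightarrow> Y = Z"
  by (auto simp: is_least_def)

text \<open>This set is itself a face through \<open>m\<close>, and upward closure puts it into
  every other such face.\<close>

lemma is_least_face_containing:
  assumes "finite N" and m: "m \<in> supermodular_cone N"
  shows "is_least {G \<in> faces N (supermodular_cone N). m \<in> G} (tight_face N (tight N m))"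
  unfolding is_least_def
  using tight_face_in_faces[OF \<open>finite N\<close> tight_subset, of m] m
    face_upward_closed[OF \<open>finite N\<close>, of _ m]
  by (auto simp: tight_face_def)

text \<open>A function tight at every pair is tight wherever a given point of a nonempty face is, so
  upward closure puts it into that face.\<close>

lemma is_least_face_lattice:
  assumes "finite N"
  shows "is_least (face_lattice N) (tight_face N (Pow N \<times> Pow N))"
  unfolding is_least_def
proof (intro conjI ballI subsetI)
  show "tight_face N (Pow N \<times> Pow N) \<in> face_lattice N"
    by (simp add: tight_face_in_face_lattice[OF assms])
next
  fix G x
  assume "G \<in> face_lattice N" and x: "x \<in> tight_face N (Pow N \<times> Pow N)"
  then obtain m where "G \<in> faces N (supermodular_cone N)" "m \<in> G"
    by (auto simp: face_lattice_def)
  then show "x \<in> G"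
    using face_upward_closed[OF assms] x tight_subset[of N m] by (fastforce simp: tight_face_def)
qed

text \<open>Inclusion of the smallest faces through points reverses inclusion of tight sets, so
  atoms correspond to tight sets that are maximal among the proper ones. Faces and scalar products
  disappear from the argument after this.\<close>

lemma extreme_iff_tight:
  assumes fin: "finite N" and m: "m \<in> supermodular_cone N"
  shows "extreme N m \<longleftrightarrow> tight N m \<noteq> Pow N \<times> Pow N \<and>
    (\<forall>x\<in>supermodular_cone N. tight N m \<subseteq> tight N x \<longrightarrow>
       tight N x = Pow N \<times> Pow N \<or> tight N x = tight N m)"
    (is "_ \<longleftrightarrow> ?nonmod \<and> ?max")
proof -
  define F where "F x = tight_face N (tight N x)" for x
  define Z where "Z = tight_face N (Pow N \<times> Pow N)"
  have F_lat: "F x \<in> face_lattice N" for x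
    unfolding F_def by (rule tight_face_in_face_lattice[OF fin tight_subset])
  have mem: "x \<in> F x" if "x \<in> supermodular_cone N" for x
    using that by (simp add: F_def tight_face_def)
  have F_sub: "F x \<subseteq> G" if "G \<in> face_lattice N" "x \<in> G" for G x
    using that face_upward_closed[OF fin, of G x]
    by (auto simp: face_lattice_def F_def tight_face_def)
  \<comment> \<open>Since \<open>x\<close> lies in its own face \<open>F x\<close>, an equality of
    faces yields the inclusions between tight sets.\<close>
  have F_Z: "F x = Z \<longleftrightarrow> tight N x = Pow N \<times> Pow N" if "x \<in> supermodular_cone N" for x
  proof
    assume "F x = Z"
    then have "x \<in> Z" using mem[OF that] by simp
    then show "tight N x = Pow N \<times> Pow N"
      using tight_subset[of N x] unfolding Z_def tight_face_def by blast
  qed (simp add: F_def Z_def)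
  have F_eq: "F x = F m \<longleftrightarrow> tight N x = tight N m" if "x \<in> supermodular_cone N" for x
  proof
    assume "F x = F m"
    then have "x \<in> F m" "m \<in> F x" using mem[OF that] mem[OF m] by auto
    then show "tight N x = tight N m" unfolding F_def tight_face_def by blast
  qed (simp add: F_def)
  have Z_least: "is_least (face_lattice N) Z"
    unfolding Z_def by (rule is_least_face_lattice[OF fin])
  \<comment> \<open>Uniqueness of least elements replaces the existential quantifiers in
    \<open>extreme\<close> and \<open>is_atom\<close> by the concrete faces \<open>F m\<close> and
    \<open>Z\<close>.\<close>
  have least_iff: "is_least {G \<in> faces N (supermodular_cone N). m \<in> G} H \<longleftrightarrow> H = F m" for H
    unfolding F_def
    using is_least_face_containing[OF fin m] is_least_unique[OF _ is_least_face_containing[OF fin m]]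
    by iprover
  have Z_iff: "is_least (face_lattice N) Y \<longleftrightarrow> Y = Z" for Y
    using Z_least is_least_unique[OF _ Z_least] by iprover
  \<comment> \<open>It suffices to test the subfaces \<open>F x\<close> generated by single points:
    a face other than \<open>Z\<close> has a point \<open>x\<close> outside \<open>Z\<close>, and
    already contains all of \<open>F x\<close>.\<close>
  have points: "(\<forall>G\<in>face_lattice N. G \<subseteq> F m \<longrightarrow> G = Z \<or> G = F m) \<longleftrightarrow>
      (\<forall>x\<in>F m. F x = Z \<or> F x = F m)" (is "?subfaces \<longleftrightarrow> ?points")
  proof
    assume sub: ?subfaces
    show ?points
    proof
      fix x assume "x \<in> F m"
      then show "F x = Z \<or> F x = F m"
        using sub F_lat[of x] F_sub[OF F_lat, of x m] by simp
    qed
  next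
    assume all: ?points
    show ?subfaces
    proof (intro ballI impI)
      fix G assume G: "G \<in> face_lattice N" "G \<subseteq> F m"
      then have ZG: "Z \<subseteq> G" using Z_least by (simp add: is_least_def)
      show "G = Z \<or> G = F m"
      proof (cases "G = Z")
        case False
        then obtain x where x: "x \<in> G" "x \<notin> Z" using ZG by blast
        then have xm: "x \<in> F m" using G by blast
        then have "x \<in> F x" by (intro mem) (simp add: F_def tight_face_def)
        then have "F x \<noteq> Z" using x by blast
        then have "F x = F m" using bspec[OF all xm] by simp
        then show ?thesis using F_sub[OF G(1) x(1)] G by simp
      qed simp
    qed
  qed
  have "extreme N m \<longleftrightarrow> is_atom (face_lattice N) (F m)"
    by (simp add: extreme_def m least_iff)
  also have "\<dots> \<longleftrightarrow> F m \<noteq> Z \<and> (\<forall>G\<in>face_lattice N. G \<subseteq> F m \<longrightarrow> G = Z \<or> G = F m)"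
    by (simp add: is_atom_def Z_iff F_lat)
  also have "\<dots> \<longleftrightarrow> F m \<noteq> Z \<and> (\<forall>x\<in>F m. F x = Z \<or> F x = F m)"
    by (simp only: points)
  also have "(\<forall>x\<in>F m. F x = Z \<or> F x = F m) \<longleftrightarrow> ?max"
  proof -
    have "(x \<in> F m \<longrightarrow> F x = Z \<or> F x = F m) \<longleftrightarrow>
        (x \<in> supermodular_cone N \<longrightarrow> tight N m \<subseteq> tight N x \<longrightarrow>
          tight N x = Pow N \<times> Pow N \<or> tight N x = tight N m)" for x
    proof (cases "x \<in> supermodular_cone N")
      case True
      have "x \<in> F m \<longleftrightarrow> tight N m \<subseteq> tight N x"
        using True by (simp add: F_def tight_face_def)
      then show ?thesis by (simp only: F_Z[OF True] F_eq[OF True] True simp_thms)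
    next
      case False
      then have "x \<notin> F m" by (simp add: F_def tight_face_def)
      with False show ?thesis by iprover
    qed
    then show ?thesis by (simp only: Ball_def)
  qed
  also have "F m = Z \<longleftrightarrow> tight N m = Pow N \<times> Pow N"
    by (rule F_Z[OF m])
  finally show ?thesis .
qed

section \<open>Lifting and restriction\<close>

lemma defect_lifting:
  assumes "A \<subseteq> N" "B \<subseteq> N"
  shows "defect (lifting M N r) A B = defect r (A \<inter> M) (B \<inter> M)"
proof -
  have "(A \<union> B) \<inter> M = A \<inter> M \<union> B \<inter> M" "A \<inter> B \<inter> M = A \<inter> M \<inter> (B \<inter> M)" by auto
  moreover have "A \<union> B \<subseteq> N" "A \<inter> B \<subseteq> N" using assms by auto
  ultimately show ?thesis using assms by (simp add: defect_def lifting_def)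
qed

lemma tight_lifting:
  "tight N (lifting M N r) = {(A, B) \<in> Pow N \<times> Pow N. (A \<inter> M, B \<inter> M) \<in> tight M r}"
  by (auto simp: tight_def defect_lifting)

text \<open>Intersecting with \<open>M\<close> does not change subsets of \<open>M\<close>, so
  \<open>S\<close> is recovered from its lifted set as the pairs lying inside
  \<open>M\<close>.\<close>

lemma lifted_pairs_mono_iff:
  assumes "M \<subseteq> N" "S \<subseteq> Pow M \<times> Pow M"
  shows "{(A, B) \<in> Pow N \<times> Pow N. (A \<inter> M, B \<inter> M) \<in> S} \<subseteq>
      {(A, B) \<in> Pow N \<times> Pow N. (A \<inter> M, B \<inter> M) \<in> T} \<longleftrightarrow> S \<subseteq> T"
proof
  assume sub: "{(A, B) \<in> Pow N \<times> Pow N. (A \<inter> M, B \<inter> M) \<in> S} \<subseteq>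
      {(A, B) \<in> Pow N \<times> Pow N. (A \<inter> M, B \<inter> M) \<in> T}"
  show "S \<subseteq> T"
  proof (rule subrelI)
    fix A B assume AB: "(A, B) \<in> S"
    then have "(A, B) \<in> Pow M \<times> Pow M" by (rule subsetD[OF assms(2)])
    then have eq: "A \<inter> M = A" "B \<inter> M = B" and "A \<subseteq> N" "B \<subseteq> N"
      using \<open>M \<subseteq> N\<close> by auto
    then have "(A, B) \<in> {(A, B) \<in> Pow N \<times> Pow N. (A \<inter> M, B \<inter> M) \<in> S}"
      using AB by simp
    then have "(A, B) \<in> {(A, B) \<in> Pow N \<times> Pow N. (A \<inter> M, B \<inter> M) \<in> T}"
      by (rule subsetD[OF sub])
    then show "(A, B) \<in> T" by (simp add: eq)
  qed
qed blast

lemma tight_lifting_subset_iff: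
  assumes "M \<subseteq> N"
  shows "tight N (lifting M N r) \<subseteq> tight N (lifting M N s) \<longleftrightarrow> tight M r \<subseteq> tight M s"
  unfolding tight_lifting by (rule lifted_pairs_mono_iff[OF assms tight_subset])

lemma tight_lifting_eq_iff:
  assumes "M \<subseteq> N"
  shows "tight N (lifting M N r) = tight N (lifting M N s) \<longleftrightarrow> tight M r = tight M s"
  by (simp add: set_eq_subset tight_lifting_subset_iff[OF assms])

lemma tight_lifting_full_iff:
  assumes "M \<subseteq> N"
  shows "tight N (lifting M N r) = Pow N \<times> Pow N \<longleftrightarrow> tight M r = Pow M \<times> Pow M"
proof -
  \<comment> \<open>The full set over \<open>N\<close> is the lifted full set over \<open>M\<close>,
    so fullness becomes an instance of monotonicity.\<close>
  have eq: "{(A, B) \<in> Pow N \<times> Pow N. (A \<inter> M, B \<inter> M) \<in> Pow M \<times> Pow M} = Pow N \<times> Pow N"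
    by auto
  have "Pow N \<times> Pow N \<subseteq> tight N (lifting M N r) \<longleftrightarrow> Pow M \<times> Pow M \<subseteq> tight M r"
    using lifted_pairs_mono_iff[OF assms subset_refl, of "tight M r"]
    by (simp only: tight_lifting eq)
  then show ?thesis by (simp only: set_eq_subset tight_subset simp_thms)
qed

lemma restrict_in_supermodular_cone:
  assumes "x \<in> supermodular_cone N" "M \<subseteq> N"
  shows "restrict x (Pow M) \<in> supermodular_cone M"
proof -
  have "A \<union> B \<subseteq> M \<and> A \<inter> B \<subseteq> M" if "A \<subseteq> M" "B \<subseteq> M" for A B using that by auto
  then show ?thesis
    using assms by (auto simp: supermodular_cone_def set_functions_def)
qed

text \<open>On \<open>Pow N\<close>, the function \<open>x\<close> differs from the lifting of its
  restriction by \<open>x (A - M) - x {}\<close>, which is modular in \<open>A\<close>; hence the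
  two have the same defects.\<close>

lemma tight_lifting_restrict:
  assumes "M \<subseteq> N" and sub: "tight N (lifting M N r) \<subseteq> tight N x"
  shows "tight N (lifting M N (restrict x (Pow M))) = tight N x"
proof -
  \<comment> \<open>Such a pair meets \<open>M\<close> in \<open>(A \<inter> M, {})\<close>, where
    every function has defect zero. So the lifting of \<open>r\<close> is tight there, and
    \<open>x\<close> inherits this.\<close>
  have outside: "defect x A B = 0" if "A \<subseteq> N" "B \<subseteq> N - M" for A B
  proof -
    have "A \<inter> M \<inter> (B \<inter> M) = {}" "A \<inter> M \<union> B \<inter> M = A \<inter> M" "B \<inter> M = {}" using that by auto
    then have "defect r (A \<inter> M) (B \<inter> M) = 0" by (simp add: defect_def)
    moreover have "B \<subseteq> N" using that by auto
    ultimately have "(A, B) \<in> tight N (lifting M N r)"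
      using that by (simp add: tight_iff defect_lifting)
    from subsetD[OF sub this] show ?thesis by (simp add: tight_iff)
  qed
  \<comment> \<open>The term \<open>x {}\<close> stays because functions are not normalised to
    vanish at the empty set.\<close>
  have split: "x A = x (A \<inter> M) + x (A - M) - x {}" if "A \<subseteq> N" for A
  proof -
    have "(A \<inter> M) \<union> (A - M) = A" "(A \<inter> M) \<inter> (A - M) = {}" by auto
    then show ?thesis
      using outside[of "A \<inter> M" "A - M"] that by (simp add: defect_def Diff_mono le_infI1)
  qed
  \<comment> \<open>Splitting \<open>x\<close> at all four sets, the copies of \<open>x {}\<close>
    cancel and the parts outside \<open>M\<close> form a defect that is zero.\<close>
  have "defect x A B = defect x (A \<inter> M) (B \<inter> M)" if "A \<subseteq> N" "B \<subseteq> N" for A B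
  proof -
    have "defect x (A - M) (B - M) = 0" using that by (intro outside) auto
    moreover have "(A \<union> B) \<inter> M = A \<inter> M \<union> B \<inter> M" "A \<inter> B \<inter> M = A \<inter> M \<inter> (B \<inter> M)"
      "A \<union> B - M = (A - M) \<union> (B - M)" "A \<inter> B - M = (A - M) \<inter> (B - M)" by auto
    moreover have "A \<union> B \<subseteq> N" "A \<inter> B \<subseteq> N" using that by auto
    ultimately show ?thesis
      using split[of A] split[of B] split[of "A \<union> B"] split[of "A \<inter> B"] that
      by (simp add: defect_def)
  qed
  moreover have "defect (restrict x (Pow M)) (A \<inter> M) (B \<inter> M) = defect x (A \<inter> M) (B \<inter> M)" for A B
  proof -
    have "A \<inter> M \<union> B \<inter> M \<subseteq> M" "A \<inter> M \<inter> (B \<inter> M) \<subseteq> M" by auto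
    then show ?thesis by (simp add: defect_def)
  qed
  ultimately show ?thesis by (auto simp: tight_iff defect_lifting)
qed

theorem corollary6:
  fixes M N :: "'a set" and m r :: "'a set \<Rightarrow> real"
  assumes "finite N" and "card N \<ge> 2" and "M \<subseteq> N"
    and "r \<in> supermodular_cone M"
    and "m = lifting M N r"
  shows "extreme N m \<longleftrightarrow> extreme M r"
proof -
  note lift_iffs = tight_lifting_subset_iff[OF \<open>M \<subseteq> N\<close>] tight_lifting_eq_iff[OF \<open>M \<subseteq> N\<close>]
    tight_lifting_full_iff[OF \<open>M \<subseteq> N\<close>]
  have "finite M" using assms finite_subset by blast
  have m: "m \<in> supermodular_cone N"
    using assms lifting_in_supermodular_cone by blast
  have "(\<forall>x\<in>supermodular_cone N. tight N m \<subseteq> tight N x \<longrightarrow>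
          tight N x = Pow N \<times> Pow N \<or> tight N x = tight N m) \<longleftrightarrow>
        (\<forall>y\<in>supermodular_cone M. tight M r \<subseteq> tight M y \<longrightarrow>
          tight M y = Pow M \<times> Pow M \<or> tight M y = tight M r)" (is "?L \<longleftrightarrow> ?R")
  proof
    assume L: ?L
    \<comment> \<open>A competitor on \<open>M\<close> is lifted to one on \<open>N\<close>; lifting
      preserves and reflects the inclusion, equality and fullness of tight sets.\<close>
    show ?R
    proof (intro ballI impI)
      fix y assume "y \<in> supermodular_cone M" "tight M r \<subseteq> tight M y"
      then show "tight M y = Pow M \<times> Pow M \<or> tight M y = tight M r"
        using L[rule_format, of "lifting M N y"] lifting_in_supermodular_cone[of y M N]
        by (simp add: \<open>m = lifting M N r\<close> lift_iffs)
    qed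
  next
    assume R: ?R
    show ?L
    proof (intro ballI impI)
      fix x assume x: "x \<in> supermodular_cone N" and sub: "tight N m \<subseteq> tight N x"
      \<comment> \<open>A competitor \<open>x\<close> on \<open>N\<close> need not be a lifting, but
        it has the tight set of the lifting of its restriction, and the condition depends on nothing
        else.\<close>
      define y where "y = restrict x (Pow M)"
      have "y \<in> supermodular_cone M"
        unfolding y_def by (rule restrict_in_supermodular_cone[OF x \<open>M \<subseteq> N\<close>])
      moreover have eq: "tight N x = tight N (lifting M N y)"
        using tight_lifting_restrict[OF \<open>M \<subseteq> N\<close>] sub
        by (simp add: \<open>m = lifting M N r\<close> y_def)
      ultimately show "tight N x = Pow N \<times> Pow N \<or> tight N x = tight N m"
        using R sub by (simp add: \<open>m = lifting M N r\<close> lift_iffs)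
    qed
  qed
  then show ?thesis
    using extreme_iff_tight[OF \<open>finite N\<close> m]
      extreme_iff_tight[OF \<open>finite M\<close> \<open>r \<in> supermodular_cone M\<close>]
    by (simp add: \<open>m = lifting M N r\<close> lift_iffs)
qed

end
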